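(* The polyhedron consisting of all $(x,\{w^{k}\}_{k=0}^{n},y,v,\lambda)$ with $x\in\mathbb{R}^n$, $w^k\in\mathbb{R}^n$ for $k=0,\dots,n$, $y\in\mathbb{R}$, $v=(v_0,\dots,v_n)\in\mathbb{R}^{n+1}$, $\lambda=(\lambda_0,\dots,\lambda_n)\in\mathbb{R}^{n+1}$, $\lambda\ge 0$, satisfying $$x_j=\sum_{k=0}^n w^k_j\ (j\in N),\qquad y=\sum_{k=0}^n v_k,\qquad \sum_{k=0}^n\lambda_k=1,$$ $$\sum_{j=1}^n w^k_j=(ku+(n-k)\ell)\lambda_k,\qquad v_k=m(x^k)\lambda_k\qquad (k=0,\dots,n),$$ $$\ell\lambda_k\le w^k_j\le u\lambda_k\qquad (j\in N,\ k=0,\dots,n)$$ projects onto $\operatorname{conv}(G)$ in the space of the variables $(x,y)$; that is, its image under $(x,\{w^k\},y,v,\lambda)\mapsto(x,y)$ equals $\operatorname{conv}(G)$.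
   Context: Let $n\ge 2$, $N=\{1,\dots,n\}$, and let $\ell<u$ be real numbers. Let $X=\{x\in\mathbb{R}^n:\ell\le x_j\le u,\ j\in N\}$. For real coefficients $c_2,\dots,c_n$ let $m(x)=\sum_{i=2}^n c_i\sum_{J\subseteq N,\ |J|=i}\prod_{j\in J}x_j$ (a symmetric multilinear polynomial), and let $G=\{(x,y)\in\mathbb{R}^n\times\mathbb{R}: x\in X,\ y=m(x)\}$, with convex hull $\operatorname{conv}(G)$. For $k=0,\dots,n$ the fixed point $x^k\in\mathbb{R}^n$ (not a power and not a variable of the polyhedron) is the vector whose first $k$ entries equal $u$ and whose last $n-k$ entries equal $\ell$; thus $m(x^k)$ is a constant. *)

theory Defs
  imports "HOL-Analysis.Analysis"
begin

text \<open>
  The index set \<open>N = {1, ..., n}\<close> is a finite linearly ordered type \<open>'n\<close>, so that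
  \<open>n = CARD('n)\<close>; the order is used only to speak of the first \<open>k\<close> entries of a vector.
\<close>

definition hcube :: "real \<Rightarrow> real \<Rightarrow> (real ^ 'n) set" where
  "hcube l u = {x. \<forall>j. l \<le> x $ j \<and> x $ j \<le> u}"

definition sym_multilinear :: "(nat \<Rightarrow> real) \<Rightarrow> real ^ 'n \<Rightarrow> real" where
  "sym_multilinear c x =
     (\<Sum>i = 2..CARD('n). c i * (\<Sum>J | card J = i. \<Prod>j\<in>J. x $ j))"

definition mgraph :: "real \<Rightarrow> real \<Rightarrow> (nat \<Rightarrow> real) \<Rightarrow> ((real ^ 'n) \<times> real) set" where
  "mgraph l u c = {(x, y). x \<in> hcube l u \<and> y = sym_multilinear c x}"

text \<open>The entry at \<open>j\<close> is among the first \<open>k\<close> entries iff fewer than \<open>k\<close> indices precede \<open>j\<close>.\<close>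

definition vertex :: "real \<Rightarrow> real \<Rightarrow> nat \<Rightarrow> real ^ ('n :: {finite, linorder})" where
  "vertex l u k = (\<chi> j. if card {i. i < j} < k then u else l)"

text \<open>
  Families indexed by \<open>k = 0, ..., n\<close> are functions on \<^typ>\<open>nat\<close> that take the fixed value
  \<^const>\<open>undefined\<close> outside \<open>{0..n}\<close>, so that each point of the extended space is represented
  exactly once.
\<close>

definition ext_polyhedron ::
    "real \<Rightarrow> real \<Rightarrow> (nat \<Rightarrow> real) \<Rightarrow>
      ((real ^ ('n :: {finite, linorder})) \<times> (nat \<Rightarrow> real ^ ('n :: {finite, linorder})) \<times> real
        \<times> (nat \<Rightarrow> real) \<times> (nat \<Rightarrow> real)) set" where
  "ext_polyhedron l u c =
     {(x, w, y, v, lam).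
        w \<in> extensional {0..CARD('n)} \<and>
        v \<in> extensional {0..CARD('n)} \<and>
        lam \<in> extensional {0..CARD('n)} \<and>
        (\<forall>k\<in>{0..CARD('n)}. 0 \<le> lam k) \<and>
        (\<forall>j. x $ j = (\<Sum>k = 0..CARD('n). w k $ j)) \<and>
        y = (\<Sum>k = 0..CARD('n). v k) \<and>
        (\<Sum>k = 0..CARD('n). lam k) = 1 \<and>
        (\<forall>k\<in>{0..CARD('n)}.
           (\<Sum>j\<in>UNIV. w k $ j) = (real k * u + (real CARD('n) - real k) * l) * lam k) \<and>
        (\<forall>k\<in>{0..CARD('n)}.
           v k = sym_multilinear c (vertex l u k :: real ^ ('n :: {finite, linorder})) * lam k) \<and>
        (\<forall>j. \<forall>k\<in>{0..CARD('n)}. l * lam k \<le> w k $ j \<and> w k $ j \<le> u * lam k)}"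

end

theory Submission
  imports Defs
begin

text \<open>
  Since \<^const>\<open>sym_multilinear\<close> is affine in each coordinate separately, every point of its graph
  over the box is a convex combination of graph points above corners of the box
  (\<open>coordinatewise_affine_graph\<close>). Since it is also symmetric, at a corner it only depends on the
  number \<open>k\<close> of entries equal to \<open>u\<close> (\<open>sym_multilinear_at_corner\<close>). So \<open>conv(G)\<close> is the convex
  hull of the union over \<open>k\<close> of the sets obtained by lifting all corners with exactly \<open>k\<close> entries
  \<open>u\<close> to the common height \<open>m(x\<^sup>k)\<close>.

  The convex hull of the corners with \<open>k\<close> entries \<open>u\<close> is exactly the slice of the box on which the
  coordinate sum is \<open>ku + (n-k)\<ell>\<close> (\<open>slice_subset_hull_corners\<close>), an affine copy of a hypersimplex. The
  polyhedron is the standard disjunctive formulation of the convex hull of the union of these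
  \<open>n + 1\<close> lifted slices: \<open>\<lambda>\<^sub>k\<close> is the weight of the \<open>k\<close>-th piece and \<open>w\<^sup>k\<close> is \<open>\<lambda>\<^sub>k\<close> times a point
  of the slice. As the slices are bounded, a zero weight forces \<open>w\<^sup>k = 0\<close>, so no
  recession directions enter the projection, and dividing \<open>w\<^sup>k\<close> by a positive weight gives a point
  of the slice (\<open>projection_ext_polyhedron_subset_hull\<close>). Conversely the projection is convex and
  contains the graph points above the corners, hence the whole graph and its hull.
\<close>

section \<open>Corners of the box and symmetry\<close>

definition corners :: "real \<Rightarrow> real \<Rightarrow> nat \<Rightarrow> (real ^ 'n) set" where
  "corners l u k = {p. (\<forall>j. p $ j = l \<or> p $ j = u) \<and> card {j. p $ j = u} = k}"

lemma corners_subset_hcube: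
  assumes "l < u"
  shows "corners l u k \<subseteq> hcube l u"
proof
  fix p :: "real ^ 'n" assume "p \<in> corners l u k"
  then have "p $ j = l \<or> p $ j = u" for j by (simp add: corners_def)
  then have "l \<le> p $ j \<and> p $ j \<le> u" for j
    using assms by (metis less_imp_le order_refl)
  then show "p \<in> hcube l u" by (simp add: hcube_def)
qed

lemma sum_corner:
  fixes p :: "real ^ 'n"
  assumes "l < u" "p \<in> corners l u k"
  shows "(\<Sum>j\<in>UNIV. p $ j) = real k * u + (real CARD('n) - real k) * l"
proof -
  let ?A = "{j. p $ j = u}"
  have k: "card ?A = k" using assms by (simp add: corners_def)
  have "(\<Sum>j\<in>UNIV. p $ j) = (\<Sum>j\<in>UNIV. l + (if j \<in> ?A then u - l else 0))"
    using assms by (intro sum.cong) (auto simp: corners_def)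
  also have "\<dots> = real CARD('n) * l + real (card ?A) * (u - l)"
    by (simp add: sum.distrib flip: sum.inter_filter)
  finally show ?thesis using k by (simp add: algebra_simps)
qed

text \<open>
  The number of predecessors is a bijection from the index type onto \<open>{0, ..., n-1}\<close>, so exactly
  \<open>k\<close> indices have fewer than \<open>k\<close> predecessors.
\<close>

lemma card_first_indices:
  assumes "k \<le> CARD('n :: {finite, linorder})"
  shows "card {j :: 'n. card {i. i < j} < k} = k"
proof -
  define r where "r = (\<lambda>j :: 'n. card {i. i < j})"
  have mono: "r a < r b" if "a < b" for a b
    unfolding r_def using that by (intro psubset_card_mono) auto
  then have inj: "inj r"
    by (metis injI linorder_neqE less_irrefl)
  have "r j < CARD('n)" for j
    unfolding r_def by (intro psubset_card_mono) auto
  then have "range r = {..<CARD('n)}"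
    using inj by (intro card_subset_eq) (auto simp: card_image)
  then have "\<exists>j. i = r j" if "i < k" for i
    using assms that by (metis imageE lessThan_iff order_less_le_trans)
  then have "r ` {j. r j < k} = {..<k}"
    by (fastforce simp: image_iff)
  then have "card {j. r j < k} = card {..<k}"
    using inj by (metis card_image inj_on_subset subset_UNIV)
  then show ?thesis by (simp add: r_def)
qed

lemma vertex_in_corners:
  assumes "l < u" "k \<le> CARD('n :: {finite, linorder})"
  shows "(vertex l u k :: real ^ ('n :: {finite, linorder})) \<in> corners l u k"
proof -
  have "{j. (vertex l u k :: real ^ ('n :: {finite, linorder})) $ j = u} = {j. card {i. i < j} < k}"
    using assms by (auto simp: vertex_def split: if_splits)
  then show ?thesis
    using card_first_indices[OF assms(2)] by (simp add: corners_def) (simp add: vertex_def)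
qed

text \<open>A permutation of the indices permutes the \<open>i\<close>-element subsets that are summed over.\<close>

lemma sym_multilinear_permute:
  fixes x :: "real ^ 'n" and \<pi> :: "'n \<Rightarrow> 'n"
  assumes "bij \<pi>"
  shows "sym_multilinear c (\<chi> j. x $ \<pi> j) = sym_multilinear c x"
proof -
  have inj: "inj \<pi>" using assms by (rule bij_is_inj)
  have "(\<Sum>J | card J = i. \<Prod>j\<in>J. x $ \<pi> j) = (\<Sum>J | card J = i. \<Prod>j\<in>J. x $ j)" for i
  proof (rule sum.reindex_bij_witness[where j = "\<lambda>J. \<pi> ` J" and i = "\<lambda>J. \<pi> -` J"])
    fix J :: "'n set" assume J: "J \<in> {J. card J = i}"
    show "\<pi> -` \<pi> ` J = J" using inj by (rule inj_vimage_image_eq)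
    show "\<pi> ` \<pi> -` J = J" using assms by (simp add: bij_is_surj surj_image_vimage_eq)
    show "\<pi> ` J \<in> {J. card J = i}"
      using J inj by (simp add: card_image inj_on_subset)
    show "\<pi> -` J \<in> {J. card J = i}"
      using J assms by (simp add: card_vimage_inj bij_is_inj bij_is_surj)
    show "(\<Prod>j\<in>\<pi> ` J. x $ j) = (\<Prod>j\<in>J. x $ \<pi> j)"
      using inj by (simp add: prod.reindex inj_on_subset)
  qed
  then show ?thesis by (simp add: sym_multilinear_def)
qed

text \<open>Bijections between \<open>A\<close> and \<open>B\<close> and between their complements are glued together.\<close>

lemma exists_permutation_of_subsets:
  fixes A B :: "'a :: finite set"
  assumes "card A = card B"
  shows "\<exists>\<pi>. bij \<pi> \<and> (\<forall>j. \<pi> j \<in> B \<longleftrightarrow> j \<in> A)"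
proof -
  obtain f where f: "bij_betw f A B"
    using assms finite_same_card_bij[of A B] by auto
  have "card (- A) = card (- B)"
    using assms by (simp add: Compl_eq_Diff_UNIV card_Diff_subset)
  then obtain g where g: "bij_betw g (- A) (- B)"
    using finite_same_card_bij[of "- A" "- B"] by auto
  let ?h = "\<lambda>j. if j \<in> A then f j else g j"
  have "bij_betw ?h (A \<union> - A) (B \<union> - B)"
    using f g by (rule bij_betw_disjoint_Un) auto
  moreover have "\<forall>j. ?h j \<in> B \<longleftrightarrow> j \<in> A"
    using bij_betwE[OF f] bij_betwE[OF g] by auto
  ultimately show ?thesis by (intro exI[of _ ?h]) simp
qed

lemma sym_multilinear_at_corner:
  fixes p q :: "real ^ 'n"
  assumes "p \<in> corners l u k" "q \<in> corners l u k"
  shows "sym_multilinear c p = sym_multilinear c q"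
proof -
  obtain \<pi> where \<pi>: "bij \<pi>" "\<And>j. q $ \<pi> j = u \<longleftrightarrow> p $ j = u"
    using exists_permutation_of_subsets[of "{j. p $ j = u}" "{j. q $ j = u}"] assms
    by (auto simp: corners_def)
  have "(\<chi> j. q $ \<pi> j) = p"
    using assms \<pi>(2) unfolding corners_def vec_eq_iff by (simp) metis
  then show ?thesis using sym_multilinear_permute[OF \<pi>(1), of c q] by simp
qed

section \<open>Graphs of coordinatewise affine functions\<close>

definition update_coord :: "real ^ 'n \<Rightarrow> 'n \<Rightarrow> real \<Rightarrow> real ^ 'n" where
  "update_coord x i s = (\<chi> j. if j = i then s else x $ j)"

definition coordinatewise_affine :: "(real ^ 'n \<Rightarrow> real) \<Rightarrow> bool" where
  "coordinatewise_affine f \<longleftrightarrow>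
     (\<forall>x i s r t. f (update_coord x i ((1 - t) * s + t * r))
        = (1 - t) * f (update_coord x i s) + t * f (update_coord x i r))"

lemma coordinatewise_affine_sum:
  assumes "\<And>a. a \<in> A \<Longrightarrow> coordinatewise_affine (f a)"
  shows "coordinatewise_affine (\<lambda>x. \<Sum>a\<in>A. f a x)"
  using assms by (simp add: coordinatewise_affine_def sum_distrib_left sum.distrib)

lemma coordinatewise_affine_cmult:
  "coordinatewise_affine f \<Longrightarrow> coordinatewise_affine (\<lambda>x. c * f x)"
  by (simp add: coordinatewise_affine_def distrib_left mult.left_commute)

lemma coordinatewise_affine_monomial:
  fixes J :: "'n :: finite set"
  shows "coordinatewise_affine (\<lambda>x. \<Prod>j\<in>J. x $ j)"
proof -
  have "(\<Prod>j\<in>J. update_coord x i s $ j)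
      = (if i \<in> J then s * (\<Prod>j\<in>J - {i}. x $ j) else (\<Prod>j\<in>J. x $ j))" for x :: "real ^ 'n" and i s
    by (auto simp: update_coord_def prod.remove[of J i] intro!: prod.cong)
  then show ?thesis
    by (simp add: coordinatewise_affine_def algebra_simps)
qed

lemma coordinatewise_affine_sym_multilinear:
  "coordinatewise_affine (sym_multilinear c)"
  unfolding sym_multilinear_def [abs_def]
  by (intro coordinatewise_affine_sum coordinatewise_affine_cmult coordinatewise_affine_monomial)

text \<open>
  Coordinates are pushed to the ends of \<open>[l, u]\<close> one at a time. Moving a single coordinate traces a
  segment along which \<open>f\<close> is affine, so the graph point lies on the segment between the graph
  points at the two ends.
\<close>

lemma coordinatewise_affine_graph:
  fixes f :: "real ^ 'n \<Rightarrow> real"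
  assumes f: "coordinatewise_affine f" and "l < u" and C: "convex C"
    and corner: "\<And>p. (\<forall>j. p $ j = l \<or> p $ j = u) \<Longrightarrow> (p, f p) \<in> C"
    and x: "x \<in> hcube l u"
  shows "(x, f x) \<in> C"
proof -
  have "(x, f x) \<in> C"
    if "finite S" "x \<in> hcube l u" "\<forall>j. j \<notin> S \<longrightarrow> x $ j = l \<or> x $ j = u" for S x
    using that
  proof (induction S arbitrary: x rule: finite_induct)
    case empty
    then show ?case by (intro corner) simp
  next
    case (insert i S)
    define t where "t = (x $ i - l) / (u - l)"
    have bounds: "l \<le> x $ i" "x $ i \<le> u"
      using insert.prems by (auto simp: hcube_def)
    have t: "0 \<le> t" "t \<le> 1"
      using bounds \<open>l < u\<close> by (auto simp: t_def divide_simps)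
    have xi: "x $ i = (1 - t) * l + t * u"
    proof -
      have "t * (u - l) = x $ i - l" using \<open>l < u\<close> by (simp add: t_def)
      then show ?thesis by (simp add: algebra_simps)
    qed
    define p where "p = update_coord x i l"
    define q where "q = update_coord x i u"
    have "p \<in> hcube l u" "q \<in> hcube l u"
      using insert.prems \<open>l < u\<close> by (auto simp: p_def q_def update_coord_def hcube_def)
    moreover have "\<forall>j. j \<notin> S \<longrightarrow> p $ j = l \<or> p $ j = u" "\<forall>j. j \<notin> S \<longrightarrow> q $ j = l \<or> q $ j = u"
      using insert.prems by (simp_all add: p_def q_def update_coord_def)
    ultimately have "(p, f p) \<in> C" "(q, f q) \<in> C"
      by (simp_all add: insert.IH)
    then have "(1 - t) *\<^sub>R (p, f p) + t *\<^sub>R (q, f q) \<in> C"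
      using C t by (intro convexD) auto
    moreover have "(1 - t) *\<^sub>R p + t *\<^sub>R q = x"
      by (auto simp: vec_eq_iff p_def q_def update_coord_def xi algebra_simps)
    moreover have "(1 - t) * f p + t * f q = f x"
    proof -
      have "update_coord x i ((1 - t) * l + t * u) = x"
        by (simp add: update_coord_def vec_eq_iff xi)
      then show ?thesis
        using f unfolding coordinatewise_affine_def p_def q_def by metis
    qed
    ultimately show ?case by simp
  qed
  from this[of UNIV] x show ?thesis by simp
qed

section \<open>Slices of the box\<close>

definition slice :: "real \<Rightarrow> real \<Rightarrow> nat \<Rightarrow> (real ^ 'n) set" where
  "slice l u k =
     {z \<in> hcube l u. (\<Sum>j\<in>UNIV. z $ j) = real k * u + (real CARD('n) - real k) * l}"

lemma hcube_eq_cbox: "hcube l u = cbox (\<chi> j. l) (\<chi> j. u)"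
  by (auto simp: hcube_def mem_box_cart)

lemma slice_eq_cbox_Int_hyperplane:
  "slice l u k = cbox (\<chi> j. l) (\<chi> j. u) \<inter>
     {z :: real ^ 'n. (\<chi> j. 1) \<bullet> z = real k * u + (real CARD('n) - real k) * l}"
  by (auto simp: slice_def inner_vec_def hcube_eq_cbox)

lemma compact_slice: "compact (slice l u k)"
  unfolding slice_eq_cbox_Int_hyperplane
  by (intro compact_Int_closed compact_cbox closed_hyperplane)

lemma convex_slice: "convex (slice l u k)"
  unfolding slice_eq_cbox_Int_hyperplane
  by (intro convex_Int convex_box convex_hyperplane)

text \<open>
  If two entries are strictly between the bounds, shifting a small amount from one to the
  other, in either direction, stays in the slice.
\<close>

lemma extreme_point_of_slice_at_most_one_interior:
  fixes z :: "real ^ 'n"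
  assumes z: "z extreme_point_of slice l u k"
    and a: "l < z $ a" "z $ a < u" and b: "l < z $ b" "z $ b < u"
  shows "a = b"
proof (rule ccontr)
  assume "a \<noteq> b"
  define e where "e = min (min (z $ a - l) (u - z $ a)) (min (z $ b - l) (u - z $ b))"
  have e: "0 < e" "e \<le> z $ a - l" "e \<le> u - z $ a" "e \<le> z $ b - l" "e \<le> u - z $ b"
    using a b by (auto simp: e_def)
  \<comment> \<open>\<open>e\<close> is the largest shift that both entries allow in both directions; the shift keeps the sum.\<close>
  define d :: "real ^ 'n" where "d = axis a e - axis b e"
  have dj: "d $ j = (if j = a then e else if j = b then - e else 0)" for j
    using \<open>a \<noteq> b\<close> by (auto simp: d_def axis_def)
  have zS: "z \<in> slice l u k" using z by (simp add: extreme_point_of_def)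
  have sum_d: "(\<Sum>j\<in>UNIV. d $ j) = 0"
    by (simp add: d_def axis_def sum_subtractf)
  have "z + d \<in> slice l u k" "z - d \<in> slice l u k"
    using zS e sum_d by (auto simp: slice_def hcube_def dj sum.distrib sum_subtractf)
  moreover have "z \<in> open_segment (z - d) (z + d)"
  proof -
    have "d \<noteq> 0" using dj[of a] e by auto
    then have "z - d \<noteq> z + d"
      using dj[of a] e by (auto simp: vec_eq_iff intro!: exI[of _ a])
    moreover have "z = midpoint (z - d) (z + d)"
      by (simp add: midpoint_def scaleR_2[symmetric])
    ultimately show ?thesis by (metis midpoint_in_open_segment)
  qed
  ultimately show False using z by (auto simp: extreme_point_of_def)
qed

text \<open>
  After rescaling \<open>[l, u]\<close> to \<open>[0, 1]\<close> the coordinate sum is the integer \<open>k\<close>, so it is impossible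
  that exactly one entry is fractional. An extreme point thus has no fractional entry, and its
  coordinate sum counts the entries equal to \<open>u\<close>.
\<close>

lemma extreme_point_of_slice_in_corners:
  fixes z :: "real ^ 'n"
  assumes "l < u" and z: "z extreme_point_of slice l u k"
  shows "z \<in> corners l u k"
proof -
  have zS: "z \<in> slice l u k" using z by (simp add: extreme_point_of_def)
  have bounds: "l \<le> z $ j" "z $ j \<le> u" for j
    using zS by (auto simp: slice_def hcube_def)
  let ?A = "{j. z $ j = u}"
  have no_interior: "z $ j = l \<or> z $ j = u" for j
  proof (rule ccontr)
    assume j: "\<not> (z $ j = l \<or> z $ j = u)"
    then have "l < z $ j" "z $ j < u" using bounds[of j] by auto
    then have others: "z $ i = l \<or> z $ i = u" if "i \<noteq> j" for i
      using extreme_point_of_slice_at_most_one_interior[OF z, of i j] bounds[of i] that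
      by fastforce
    have "(\<Sum>i\<in>UNIV. z $ i)
        = (\<Sum>i\<in>UNIV. l + (if i \<in> ?A then u - l else 0) + (if i = j then z $ j - l else 0))"
      using j others by (intro sum.cong) auto
    also have "\<dots> = real CARD('n) * l + real (card ?A) * (u - l) + (z $ j - l)"
      by (simp add: sum.distrib flip: sum.inter_filter)
    finally have eq: "z $ j - l = (real k - real (card ?A)) * (u - l)"
      using zS by (simp add: slice_def algebra_simps)
    have "0 * (u - l) < (real k - real (card ?A)) * (u - l)"
      "(real k - real (card ?A)) * (u - l) < 1 * (u - l)"
      unfolding eq [symmetric] using \<open>l < z $ j\<close> \<open>z $ j < u\<close> by simp_all
    then have "0 < real k - real (card ?A)" "real k - real (card ?A) < 1"
      using \<open>l < u\<close> by (metis diff_gt_0_iff_gt mult_less_cancel_right_pos)+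
    then have "real (card ?A) < real k" "real k < real (card ?A + 1)" by simp_all
    then show False unfolding of_nat_less_iff by simp
  qed
  then have "z \<in> corners l u (card ?A)" by (simp add: corners_def)
  from sum_corner[OF \<open>l < u\<close> this]
  have "(real k - real (card ?A)) * (u - l) = 0"
    using zS by (simp add: slice_def algebra_simps)
  then have "card ?A = k" using \<open>l < u\<close> by simp
  with no_interior show ?thesis by (simp add: corners_def)
qed

lemma slice_subset_hull_corners:
  assumes "l < u"
  shows "slice l u k \<subseteq> convex hull (corners l u k)"
proof -
  have "slice l u k = convex hull {z. z extreme_point_of slice l u k}"
    by (intro Krein_Milman_Minkowski compact_slice convex_slice)
  also have "\<dots> \<subseteq> convex hull (corners l u k)"
    using extreme_point_of_slice_in_corners[OF assms] by (intro hull_mono) auto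
  finally show ?thesis .
qed

lemma corners_subset_slice:
  assumes "l < u"
  shows "corners l u k \<subseteq> slice l u k"
  using corners_subset_hcube[OF assms] sum_corner[OF assms] by (auto simp: slice_def)

text \<open>
  The polynomial is constant on the corners that generate the slice, so the slice placed at that
  constant height is generated by points of the graph.
\<close>

lemma lifted_slice_subset_hull_graph:
  assumes "l < u" "k \<le> CARD('n :: {finite, linorder})"
  shows "(slice l u k :: (real ^ ('n :: {finite, linorder})) set)
             \<times> {sym_multilinear c (vertex l u k :: real ^ ('n :: {finite, linorder}))}
           \<subseteq> convex hull (mgraph l u c)"
proof -
  let ?m = "sym_multilinear c (vertex l u k :: real ^ ('n :: {finite, linorder}))"
  have "(slice l u k :: (real ^ ('n :: {finite, linorder})) set) \<times> {?m}
      \<subseteq> (convex hull (corners l u k)) \<times> (convex hull {?m})"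
    using slice_subset_hull_corners[OF assms(1)] by auto
  also have "\<dots> = convex hull (corners l u k \<times> {?m})"
    by (simp add: convex_hull_Times)
  also have "\<dots> \<subseteq> convex hull (mgraph l u c)"
  proof (rule hull_mono, rule subsetI)
    fix z :: "(real ^ ('n :: {finite, linorder})) \<times> real"
    assume "z \<in> corners l u k \<times> {?m}"
    then obtain p where z: "z = (p, ?m)" and p: "p \<in> corners l u k" by auto
    have "?m = sym_multilinear c p"
      using vertex_in_corners[OF assms] p by (rule sym_multilinear_at_corner)
    then show "z \<in> mgraph l u c"
      using corners_subset_hcube[OF assms(1)] p z by (auto simp: mgraph_def)
  qed
  finally show ?thesis .
qed

section \<open>The projection of the polyhedron\<close>

text \<open>
  Here \<open>v\<close> is eliminated through \<open>v\<^sub>k = m(x\<^sup>k) \<lambda>\<^sub>k\<close> and the families are arbitrary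
  functions on \<^typ>\<open>nat\<close>, which can be added and scaled pointwise, something that the fixed default value outside \<open>{0, ..., n}\<close> would prevent.
\<close>

lemma projection_ext_polyhedron:
  "(\<lambda>(x, w, y, v, lam). (x, y)) ` ext_polyhedron l u c =
     {(x :: real ^ ('n :: {finite, linorder}), y). \<exists>w lam.
        (\<forall>k\<le>CARD('n). 0 \<le> lam k) \<and>
        x = (\<Sum>k\<le>CARD('n). w k) \<and>
        y = (\<Sum>k\<le>CARD('n). sym_multilinear c (vertex l u k :: real ^ ('n :: {finite, linorder})) * lam k) \<and>
        (\<Sum>k\<le>CARD('n). lam k) = 1 \<and>
        (\<forall>k\<le>CARD('n). (\<Sum>j\<in>UNIV. w k $ j) = (real k * u + (real CARD('n) - real k) * l) * lam k) \<and>
        (\<forall>j. \<forall>k\<le>CARD('n). l * lam k \<le> w k $ j \<and> w k $ j \<le> u * lam k)}"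
  (is "?L = ?R")
proof
  show "?L \<subseteq> ?R"
  proof
    fix z assume "z \<in> ?L"
    then obtain x w y v lam where "z = (x, y)" "(x, w, y, v, lam) \<in> ext_polyhedron l u c"
      by auto
    then show "z \<in> ?R"
      unfolding ext_polyhedron_def mem_Collect_eq prod.case
      by (simp add: atLeast0AtMost vec_eq_iff) (intro exI[of _ w] exI[of _ lam], simp)
  qed
  show "?R \<subseteq> ?L"
  proof safe
    fix x :: "real ^ ('n :: {finite, linorder})" and y w lam
    let ?I = "{0..CARD('n)}"
    let ?m = "\<lambda>k. sym_multilinear c (vertex l u k :: real ^ ('n :: {finite, linorder}))"
    assume "\<forall>k\<le>CARD('n). 0 \<le> lam k" "(\<Sum>k\<le>CARD('n). lam k) = 1"
      "\<forall>k\<le>CARD('n). (\<Sum>j\<in>UNIV. w k $ j) = (real k * u + (real CARD('n) - real k) * l) * lam k"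
      "\<forall>j. \<forall>k\<le>CARD('n). l * lam k \<le> (w k :: real ^ ('n :: {finite, linorder})) $ j \<and> w k $ j \<le> u * lam k"
    then have "(\<Sum>k\<le>CARD('n). w k, restrict w ?I, \<Sum>k\<le>CARD('n). ?m k * lam k,
        restrict (\<lambda>k. ?m k * lam k) ?I, restrict lam ?I) \<in> ext_polyhedron l u c"
      by (simp add: ext_polyhedron_def atLeast0AtMost)
    then show "(\<Sum>k\<le>CARD('n). w k, \<Sum>k\<le>CARD('n). ?m k * lam k) \<in> ?L"
      by (rule rev_image_eqI) simp
  qed
qed

text \<open>
  Every condition is linear in \<open>(x, w, y, \<lambda>)\<close>, so the pointwise convex combination of two witnesses
  is a witness for the convex combination of the two points.
\<close>

lemma convex_projection_ext_polyhedron: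
  "convex ((\<lambda>(x, w, y, v, lam). (x :: real ^ ('n :: {finite, linorder}), y)) ` ext_polyhedron l u c)"
  unfolding projection_ext_polyhedron
proof (rule convexI, clarify, unfold scaleR_Pair add_Pair mem_Collect_eq prod.case)
  fix s t :: real and w1 w2 :: "nat \<Rightarrow> real ^ ('n :: {finite, linorder})" and lam1 lam2 :: "nat \<Rightarrow> real"
    and x y
  let ?m = "\<lambda>k. sym_multilinear c (vertex l u k :: real ^ ('n :: {finite, linorder}))"
  let ?K = "\<lambda>k. real k * u + (real CARD('n) - real k) * l"
  assume st: "0 \<le> s" "0 \<le> t" "s + t = 1"
    and xy: "(s *\<^sub>R (\<Sum>k\<le>CARD('n). w1 k) + t *\<^sub>R (\<Sum>k\<le>CARD('n). w2 k),
        s *\<^sub>R (\<Sum>k\<le>CARD('n). ?m k * lam1 k) + t *\<^sub>R (\<Sum>k\<le>CARD('n). ?m k * lam2 k)) = (x, y)"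
    and 1: "\<forall>k\<le>CARD('n). 0 \<le> lam1 k" "(\<Sum>k\<le>CARD('n). lam1 k) = 1"
      "\<forall>k\<le>CARD('n). (\<Sum>j\<in>UNIV. w1 k $ j) = ?K k * lam1 k"
      "\<forall>j. \<forall>k\<le>CARD('n). l * lam1 k \<le> w1 k $ j \<and> w1 k $ j \<le> u * lam1 k"
    and 2: "\<forall>k\<le>CARD('n). 0 \<le> lam2 k" "(\<Sum>k\<le>CARD('n). lam2 k) = 1"
      "\<forall>k\<le>CARD('n). (\<Sum>j\<in>UNIV. w2 k $ j) = ?K k * lam2 k"
      "\<forall>j. \<forall>k\<le>CARD('n). l * lam2 k \<le> w2 k $ j \<and> w2 k $ j \<le> u * lam2 k"
  let ?w = "\<lambda>k. s *\<^sub>R w1 k + t *\<^sub>R w2 k"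
  let ?lam = "\<lambda>k. s * lam1 k + t * lam2 k"
  have bounds: "l * ?lam k \<le> ?w k $ j \<and> ?w k $ j \<le> u * ?lam k" if "k \<le> CARD('n)" for j k
  proof -
    have "s * (l * lam1 k) + t * (l * lam2 k) \<le> s * w1 k $ j + t * w2 k $ j"
      "s * w1 k $ j + t * w2 k $ j \<le> s * (u * lam1 k) + t * (u * lam2 k)"
      using st 1(4) 2(4) that by (auto intro!: add_mono mult_left_mono)
    then show ?thesis by (simp add: algebra_simps)
  qed
  have sums: "(\<Sum>j\<in>UNIV. ?w k $ j) = ?K k * ?lam k" if "k \<le> CARD('n)" for k
  proof -
    have "(\<Sum>j\<in>UNIV. ?w k $ j) = s * (?K k * lam1 k) + t * (?K k * lam2 k)"
      using 1(3) 2(3) that by (simp add: sum.distrib flip: sum_distrib_left)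
    then show ?thesis by (simp add: distrib_left mult.left_commute)
  qed
  have "\<forall>k\<le>CARD('n). 0 \<le> ?lam k" using st 1(1) 2(1) by simp
  moreover have "(\<Sum>k\<le>CARD('n). ?lam k) = 1"
    using st 1(2) 2(2) by (simp add: sum.distrib flip: sum_distrib_left)
  moreover have "x = (\<Sum>k\<le>CARD('n). ?w k)"
    using xy by (auto simp: sum.distrib scaleR_sum_right)
  moreover have "y = (\<Sum>k\<le>CARD('n). ?m k * ?lam k)"
    using xy by (auto simp: sum.distrib sum_distrib_left distrib_left mult.left_commute)
  ultimately show "\<exists>w lam. (\<forall>k\<le>CARD('n). 0 \<le> lam k) \<and>
      x = (\<Sum>k\<le>CARD('n). w k) \<and>
      y = (\<Sum>k\<le>CARD('n). ?m k * lam k) \<and>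
      (\<Sum>k\<le>CARD('n). lam k) = 1 \<and>
      (\<forall>k\<le>CARD('n). (\<Sum>j\<in>UNIV. w k $ j) = ?K k * lam k) \<and>
      (\<forall>j. \<forall>k\<le>CARD('n). l * lam k \<le> w k $ j \<and> w k $ j \<le> u * lam k)"
    using bounds sums by (intro exI[of _ ?w] exI[of _ ?lam]) simp
qed

text \<open>
  All weight is put on the piece that counts the entries \<open>u\<close> of \<open>p\<close>; by symmetry the height
  prescribed there by the representative \<^const>\<open>vertex\<close> is the height of \<open>p\<close>.
\<close>

lemma corner_in_projection_ext_polyhedron:
  fixes p :: "real ^ ('n :: {finite, linorder})"
  assumes "l < u" and p: "\<forall>j. p $ j = l \<or> p $ j = u"
  shows "(p, sym_multilinear c p) \<in> (\<lambda>(x, w, y, v, lam). (x, y)) ` ext_polyhedron l u c"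
proof -
  define r where "r = card {j. p $ j = u}"
  have r: "r \<le> CARD('n)" unfolding r_def by (intro card_mono) auto
  have pr: "p \<in> corners l u r" using p by (simp add: corners_def r_def)
  have m: "sym_multilinear c (vertex l u r :: real ^ ('n :: {finite, linorder})) = sym_multilinear c p"
    using vertex_in_corners[OF assms(1) r] pr by (rule sym_multilinear_at_corner)
  have bounds: "l \<le> p $ j" "p $ j \<le> u" for j
    using corners_subset_hcube[OF assms(1)] pr by (auto simp: hcube_def)
  show ?thesis
    unfolding projection_ext_polyhedron mem_Collect_eq prod.case
    using r bounds sum_corner[OF assms(1) pr]
    by (rule_tac exI[of _ "\<lambda>k. if k = r then p else 0"],
        rule_tac exI[of _ "\<lambda>k. if k = r then 1 else 0"])
      (auto simp: if_distrib[of "(*) _"] m cong: if_cong)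
qed

text \<open>
  A point of the polyhedron is a convex combination with weights \<open>\<lambda>\<^sub>k\<close> of points of the lifted
  slices, and these slices lie in the hull of the graph.
\<close>

lemma projection_ext_polyhedron_subset_hull:
  assumes "l < u"
  shows "(\<lambda>(x, w, y, v, lam). (x :: real ^ ('n :: {finite, linorder}), y)) ` ext_polyhedron l u c
           \<subseteq> convex hull (mgraph l u c)"
  unfolding projection_ext_polyhedron
proof clarify
  fix w :: "nat \<Rightarrow> real ^ ('n :: {finite, linorder})" and lam :: "nat \<Rightarrow> real"
  let ?m = "\<lambda>k. sym_multilinear c (vertex l u k :: real ^ ('n :: {finite, linorder}))"
  let ?K = "\<lambda>k. real k * u + (real CARD('n) - real k) * l"
  assume nonneg: "\<forall>k\<le>CARD('n). 0 \<le> lam k" and total: "(\<Sum>k\<le>CARD('n). lam k) = 1"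
    and sums: "\<forall>k\<le>CARD('n). (\<Sum>j\<in>UNIV. w k $ j) = ?K k * lam k"
    and bounds: "\<forall>j. \<forall>k\<le>CARD('n). l * lam k \<le> w k $ j \<and> w k $ j \<le> u * lam k"
  \<comment> \<open>A piece of weight zero contributes nothing, so any point of its slice will do.\<close>
  define z where "z = (\<lambda>k. if lam k = 0 then vertex l u k else (1 / lam k) *\<^sub>R w k)"
  have z_slice: "z k \<in> slice l u k" if k: "k \<le> CARD('n)" for k
  proof (cases "lam k = 0")
    case True
    then show ?thesis
      using vertex_in_corners[OF assms k] corners_subset_slice[OF assms] by (auto simp: z_def)
  next
    case False
    with nonneg k have "0 < lam k" by (simp add: order_less_le)
    then show ?thesis
      using bounds sums k
      by (simp add: z_def slice_def hcube_def field_simps flip: sum_divide_distrib)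
  qed
  have w: "w k = lam k *\<^sub>R z k" if "k \<le> CARD('n)" for k
  proof (cases "lam k = 0")
    case True
    then have "w k $ j = 0" for j
      using bounds[rule_format, OF that, of j] True by simp
    then show ?thesis using True by (simp add: vec_eq_iff)
  qed (simp add: z_def)
  have "(z k, ?m k) \<in> convex hull (mgraph l u c)" if "k \<le> CARD('n)" for k
    using lifted_slice_subset_hull_graph[OF assms that] z_slice[OF that] by blast
  then have "(\<Sum>k\<le>CARD('n). lam k *\<^sub>R (z k, ?m k)) \<in> convex hull (mgraph l u c)"
    using nonneg total by (intro convex_sum) auto
  also have "(\<Sum>k\<le>CARD('n). lam k *\<^sub>R (z k, ?m k))
      = (\<Sum>k\<le>CARD('n). w k, \<Sum>k\<le>CARD('n). ?m k * lam k)"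
    using w by (simp add: prod_eq_iff fst_sum snd_sum mult.commute)
  finally show "(\<Sum>k\<le>CARD('n). w k, \<Sum>k\<le>CARD('n). ?m k * lam k) \<in> convex hull (mgraph l u c)" .
qed

theorem proposition2p1:
  fixes l u :: real and c :: "nat \<Rightarrow> real"
  assumes "CARD('n) \<ge> 2"
    and "l < u"
  shows "(\<lambda>(x, w, y, v, lam). (x, y)) ` ext_polyhedron l u c
         = convex hull (mgraph l u c :: ((real ^ ('n :: {finite, linorder})) \<times> real) set)"
proof
  show "(\<lambda>(x, w, y, v, lam). (x, y)) ` ext_polyhedron l u c
      \<subseteq> convex hull (mgraph l u c :: ((real ^ ('n :: {finite, linorder})) \<times> real) set)"
    using assms(2) by (rule projection_ext_polyhedron_subset_hull)
  have "mgraph l u c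
      \<subseteq> (\<lambda>(x, w, y, v, lam). (x :: real ^ ('n :: {finite, linorder}), y)) ` ext_polyhedron l u c"
    using coordinatewise_affine_graph[OF coordinatewise_affine_sym_multilinear assms(2)
        convex_projection_ext_polyhedron corner_in_projection_ext_polyhedron[OF assms(2)]]
    by (auto simp: mgraph_def)
  then show "convex hull (mgraph l u c :: ((real ^ ('n :: {finite, linorder})) \<times> real) set)
      \<subseteq> (\<lambda>(x, w, y, v, lam). (x, y)) ` ext_polyhedron l u c"
    using convex_projection_ext_polyhedron by (rule hull_minimal)
qed

end
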